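(* Let $\frac12\le\lambda\le1$ and let $f\in\mathcal{F}_0(\lambda)$ with $f''(0)=0$. Then $$\|P_f\|\le 1+2\lambda.$$ The inequality is sharp: for each such $\lambda$, the constant $1+2\lambda$ cannot be replaced by a smaller one valid for all $f\in\mathcal{F}_0(\lambda)$ with $f''(0)=0$.
   Context: $\mathbb{D}=\{z\in\mathbb{C}:|z|<1\}$. $\mathcal{A}$ is the class of analytic functions $f$ on $\mathbb{D}$ with $f(0)=0$ and $f'(0)=1$. An analytic $f$ on $\mathbb{D}$ is locally univalent if $f'(z)\ne0$ for all $z\in\mathbb{D}$. For $\frac12\le\lambda\le1$, $\mathcal{F}_0(\lambda)$ (Ozaki close-to-convex functions) is the class of locally univalent $f\in\mathcal{A}$ with $\mathrm{Re}\left(1+\frac{zf''(z)}{f'(z)}\right)>\frac12-\lambda$ for all $z\in\mathbb{D}$. For locally univalent $f$, the pre-Schwarzian derivative is $P_f=f''/f'$ and the pre-Schwarzian norm is $\|P_f\|=\sup_{z\in\mathbb{D}}(1-|z|^2)|P_f(z)|$. *)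

theory Defs
  imports "HOL-Complex_Analysis.Complex_Analysis"
begin

abbreviation unit_disc :: "complex set" where
  "unit_disc \<equiv> ball 0 1"

text \<open>
  Functions on the disc are total functions on the complex plane; their values outside the
  (open) disc are irrelevant, since derivatives are only taken at points of the disc.
\<close>

definition class_A :: "(complex \<Rightarrow> complex) set" where
  "class_A = {f. f analytic_on unit_disc \<and> f 0 = 0 \<and> deriv f 0 = 1}"

definition locally_univalent :: "(complex \<Rightarrow> complex) \<Rightarrow> bool" where
  "locally_univalent f \<longleftrightarrow>
     f analytic_on unit_disc \<and> (\<forall>z\<in>unit_disc. deriv f z \<noteq> 0)"

definition ozaki_close_to_convex :: "real \<Rightarrow> (complex \<Rightarrow> complex) set" where
  "ozaki_close_to_convex lam =
     {f \<in> class_A. locally_univalent f \<and>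
        (\<forall>z\<in>unit_disc. Re (1 + z * deriv (deriv f) z / deriv f z) > 1/2 - lam)}"

definition pre_Schwarzian :: "(complex \<Rightarrow> complex) \<Rightarrow> complex \<Rightarrow> complex" where
  "pre_Schwarzian f z = deriv (deriv f) z / deriv f z"

text \<open>
  The supremum is taken in the extended reals, so that it is meaningful (namely infinite)
  also for functions whose pre-Schwarzian norm is not finite.
\<close>

definition pre_Schwarzian_norm :: "(complex \<Rightarrow> complex) \<Rightarrow> ereal" where
  "pre_Schwarzian_norm f =
     (SUP z\<in>unit_disc. ereal ((1 - (cmod z)\<^sup>2) * cmod (pre_Schwarzian f z)))"

end

theory Submission
  imports Defs
begin

text \<open>
  Put \<open>c = 1/2 + \<lambda>\<close>. The condition on \<open>f\<close> says that \<open>Re (z P\<^sub>f(z)) > - c\<close>, so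
  \<open>z P\<^sub>f(z) = 2 c \<omega>(z) / (1 - \<omega>(z))\<close> for a self-map \<open>\<omega>\<close> of the disc, and \<open>f''(0) = 0\<close>
  makes \<open>\<omega>\<close> vanish to second order at the origin. Hence \<open>\<bar>\<omega>(z)\<bar> \<le> \<bar>z\<bar>\<^sup>2\<close> by the Schwarz lemma,
  which gives \<open>(1 - \<bar>z\<bar>\<^sup>2) \<bar>P\<^sub>f(z)\<bar> \<le> 2 c \<bar>z\<bar>\<close>. The value \<open>2 c\<close> is
  approached along real \<open>z \<rightarrow> 1\<close> for \<open>\<omega>(z) = z\<^sup>2\<close>, that is, for \<open>f'(z) = (1 - z\<^sup>2) powr (- c)\<close>.
\<close>

text \<open>The Schwarz lemma is used twice. For \<open>w z = z * g z\<close> it gives only |g|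
  \<le> 1 off the origin, while applying it to \<open>g\<close> needs |g| < 1. Equality at one point
  would make \<open>w\<close> a rotation, whose derivative at 0 has modulus 1, although w'(0) = g(0)
  = 0.\<close>

lemma Schwarz_Lemma_second_order:
  assumes holg: "g holomorphic_on unit_disc" and g0: "g 0 = 0"
    and less: "\<And>z. z \<in> unit_disc \<Longrightarrow> cmod (z * g z) < 1" and z: "z \<in> unit_disc"
  shows "cmod (g z) \<le> cmod z"
proof -
  define w where "w = (\<lambda>z. z * g z)"
  have holw: "w holomorphic_on unit_disc" unfolding w_def by (intro holomorphic_intros holg)
  have w0: "w 0 = 0" by (simp add: w_def)
  have wless: "cmod (w z) < 1" if "cmod z < 1" for z using less[of z] that by (simp add: w_def)
  have "(w has_field_derivative 0 * deriv g 0 + 1 * g 0) (at 0)"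
    unfolding w_def
    by (rule derivative_eq_intros holomorphic_derivI[OF holg] | simp)+
  then have dw: "deriv w 0 = 0" using g0 by (simp add: DERIV_imp_deriv)
  have gless: "cmod (g z) < 1" if nz: "cmod z < 1" for z
  proof (cases "z = 0")
    case False
    have "cmod (w z) \<le> cmod z" using Schwarz_Lemma(1)[OF holw w0 wless] nz by blast
    moreover have "cmod (w z) \<noteq> cmod z"
    proof
      assume "cmod (w z) = cmod z"
      then obtain \<alpha> where \<alpha>: "\<And>z. cmod z < 1 \<Longrightarrow> w z = \<alpha> * z" "cmod \<alpha> = 1"
        using Schwarz_Lemma(3)[OF holw w0 wless] nz False by blast
      have "((\<lambda>z. \<alpha> * z) has_field_derivative \<alpha>) (at 0)"
        by (rule derivative_eq_intros | simp)+
      then have "(w has_field_derivative \<alpha>) (at 0)"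
        by (rule has_field_derivative_transform_within_open[where S = unit_disc]) (auto simp: \<alpha>)
      with dw \<alpha>(2) show False by (simp add: DERIV_imp_deriv)
    qed
    ultimately show ?thesis using False by (simp add: w_def norm_mult)
  qed (simp add: g0)
  show ?thesis using Schwarz_Lemma(1)[OF holg g0 gless] z by auto
qed

lemma growth_of_Re_bounded_below:
  assumes c: "c > 0" and holP: "P holomorphic_on unit_disc" and P0: "P 0 = 0"
    and Re: "\<And>z. z \<in> unit_disc \<Longrightarrow> Re (z * P z) > - c" and z: "z \<in> unit_disc"
  shows "(1 - (cmod z)\<^sup>2) * cmod (P z) \<le> 2 * c * cmod z"
proof -
  \<comment> \<open>This is \<omega>(z) / z, where \<omega> solves z P(z) = 2 c \<omega> / (1 -
    \<omega>). Cancelling the factor z beforehand avoids a removable singularity at 0.\<close>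
  define g where "g = (\<lambda>z. P z / (2 * of_real c + z * P z))"
  have nz: "2 * of_real c + z * P z \<noteq> 0" if "z \<in> unit_disc" for z
  proof
    assume "2 * of_real c + z * P z = 0"
    then have "Re (2 * of_real c + z * P z) = 0" by (simp only: zero_complex.simps)
    with Re[OF that] c show False by simp
  qed
  have holg: "g holomorphic_on unit_disc"
    unfolding g_def using nz by (intro holomorphic_intros holP) auto
  have less: "cmod (z * g z) < 1" if z: "z \<in> unit_disc" for z
  proof -
    define u where "u = z * P z"
    \<comment> \<open>The right-hand side is |2c + u|^2 - |u|^2: the half-plane Re u > -c consists
      of the points closer to 0 than to -2c.\<close>
    have "0 < 4 * c * (c + Re u)" using Re[OF z] c by (simp add: u_def)
    then have "(cmod u)\<^sup>2 < (cmod (2 * of_real c + u))\<^sup>2"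
      unfolding cmod_power2 by (simp add: power2_eq_square algebra_simps)
    then have "cmod u < cmod (2 * of_real c + u)"
      by (rule power2_less_imp_less) simp
    then have "cmod (u / (2 * of_real c + u)) < 1"
      using nz[OF z] by (simp add: norm_divide u_def)
    then show ?thesis by (simp add: g_def u_def)
  qed
  have gz: "cmod (g z) \<le> cmod z"
    by (rule Schwarz_Lemma_second_order[OF holg _ less z]) (simp_all add: g_def P0)
  \<comment> \<open>Solving the definition of \<open>g\<close> for \<open>P\<close> reduces the
    claim to |1 - z g(z)| \<ge> 1 - |z|^2, which follows from |g(z)| \<le> |z|.\<close>
  have "P z * (1 - z * g z) = 2 * of_real c * g z"
    using nz[OF z] by (simp add: g_def field_simps)
  then have eq: "cmod (P z) * cmod (1 - z * g z) = 2 * c * cmod (g z)"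
    using c by (metis norm_mult norm_of_real abs_of_pos norm_numeral)
  have "cmod (z * g z) \<le> (cmod z)\<^sup>2"
    using gz by (simp add: norm_mult power2_eq_square mult_left_mono)
  moreover have "1 - cmod (z * g z) \<le> cmod (1 - z * g z)"
    using norm_triangle_ineq2[of 1 "z * g z"] by simp
  ultimately have "(1 - (cmod z)\<^sup>2) * cmod (P z) \<le> cmod (1 - z * g z) * cmod (P z)"
    by (intro mult_right_mono) auto
  also have "\<dots> = 2 * c * cmod (g z)" using eq by (simp add: mult.commute)
  also have "\<dots> \<le> 2 * c * cmod z" using gz c by simp
  finally show ?thesis .
qed

text \<open>Integrate twice: f' is the exponential of a primitive of \<open>P\<close>, hence has no
  zeros, and \<open>f\<close> is a primitive of f'. Subtracting \<open>L 0\<close> and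
  \<open>F 0\<close> gives f'(0) = 1 and f(0) = 0.\<close>

lemma ex_with_pre_Schwarzian:
  assumes holP: "P holomorphic_on unit_disc"
  obtains f where "f \<in> class_A" "locally_univalent f"
    "\<And>z. z \<in> unit_disc \<Longrightarrow> deriv (deriv f) z = P z * deriv f z"
proof -
  obtain L where L: "\<And>z. z \<in> unit_disc \<Longrightarrow> (L has_field_derivative P z) (at z)"
    using holomorphic_convex_primitive'[OF convex_ball open_ball holP]
    by (metis at_within_open open_ball)
  define h where "h = (\<lambda>z. exp (L z - L 0))"
  have h: "(h has_field_derivative P z * h z) (at z)" if "z \<in> unit_disc" for z
    unfolding h_def by (rule derivative_eq_intros L[OF that] | simp)+
  then have holh: "h holomorphic_on unit_disc"
    by (meson holomorphic_onI field_differentiable_at_within field_differentiable_def)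
  obtain F where F: "\<And>z. z \<in> unit_disc \<Longrightarrow> (F has_field_derivative h z) (at z)"
    using holomorphic_convex_primitive'[OF convex_ball open_ball holh]
    by (metis at_within_open open_ball)
  define f where "f = (\<lambda>z. F z - F 0)"
  have f: "(f has_field_derivative h z) (at z)" if "z \<in> unit_disc" for z
    unfolding f_def by (rule derivative_eq_intros F[OF that] | simp)+
  then have anf: "f analytic_on unit_disc"
    by (metis analytic_on_open open_ball holomorphic_onI field_differentiable_at_within
        field_differentiable_def)
  have df: "deriv f z = h z" if "z \<in> unit_disc" for z
    using f[OF that] by (rule DERIV_imp_deriv)
  have ddf: "deriv (deriv f) z = P z * deriv f z" if z: "z \<in> unit_disc" for z
  proof -
    \<comment> \<open>\<open>deriv f\<close> is known to agree with \<open>h\<close> only on the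
      disc, so the derivative is transferred along this open set.\<close>
    have "(deriv f has_field_derivative P z * h z) (at z)"
      using h[OF z] by (rule has_field_derivative_transform_within_open[where S = unit_disc])
        (use z in \<open>auto simp: df\<close>)
    then show ?thesis using df[OF z] by (simp add: DERIV_imp_deriv)
  qed
  have "f \<in> class_A" using anf by (simp add: class_A_def df) (simp add: f_def h_def)
  moreover have "locally_univalent f" using anf df by (simp add: locally_univalent_def h_def)
  ultimately show thesis using ddf by (rule that)
qed

text \<open>After multiplication by 2 |1 - w|^2 the inequality becomes |w|^2 < 1.\<close>

lemma Re_div_one_minus_gt:
  assumes "cmod w < 1"
  shows "Re (w / (1 - w)) > - 1/2"
proof -
  have w1: "1 - w \<noteq> 0" using assms by auto
  have "(cmod w)\<^sup>2 < 1" using assms by (simp add: power_less_one_iff)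
  then have "(Re w)\<^sup>2 + (Im w)\<^sup>2 < 1" by (simp add: cmod_power2)
  moreover have "(1 - Re w)\<^sup>2 + (Im w)\<^sup>2 > 0"
    using w1 by (simp add: complex_eq_iff sum_power2_gt_zero_iff)
  ultimately show ?thesis
    by (simp add: Re_divide field_simps power2_eq_square)
qed

text \<open>The case \<omega>(z) = z^2. Prescribing the pre-Schwarzian and integrating avoids
  computing with complex powers.\<close>

lemma extremal_ozaki_close_to_convex:
  assumes "1/2 \<le> lam"
  obtains f where "f \<in> ozaki_close_to_convex lam"
    "\<And>z. z \<in> unit_disc \<Longrightarrow> pre_Schwarzian f z = of_real (1 + 2 * lam) * z / (1 - z\<^sup>2)"
proof -
  define P where "P = (\<lambda>z. complex_of_real (1 + 2 * lam) * z / (1 - z\<^sup>2))"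
  have sq: "cmod (z\<^sup>2) < 1" if "z \<in> unit_disc" for z
    using that by (simp add: norm_power power_less_one_iff)
  have "1 - z\<^sup>2 \<noteq> 0" if "z \<in> unit_disc" for z using sq[OF that] by auto
  then have "P holomorphic_on unit_disc" unfolding P_def by (intro holomorphic_intros)
  then obtain f where f: "f \<in> class_A" "locally_univalent f"
    and ddf: "\<And>z. z \<in> unit_disc \<Longrightarrow> deriv (deriv f) z = P z * deriv f z"
    by (rule ex_with_pre_Schwarzian) blast
  have df: "deriv f z \<noteq> 0" if "z \<in> unit_disc" for z
    using f(2) that by (simp add: locally_univalent_def)
  have pS: "pre_Schwarzian f z = P z" if "z \<in> unit_disc" for z
    using ddf[OF that] df[OF that] by (simp add: pre_Schwarzian_def)
  have "Re (1 + z * deriv (deriv f) z / deriv f z) > 1/2 - lam" if z: "z \<in> unit_disc" for z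
  proof -
    have "z * deriv (deriv f) z / deriv f z = of_real (1 + 2 * lam) * (z\<^sup>2 / (1 - z\<^sup>2))"
      using ddf[OF z] df[OF z] by (simp add: P_def power2_eq_square)
    then have "Re (1 + z * deriv (deriv f) z / deriv f z)
        = 1 + (1 + 2 * lam) * Re (z\<^sup>2 / (1 - z\<^sup>2))"
      by (simp only: plus_complex.sel one_complex.sel times_complex.sel
          Re_complex_of_real Im_complex_of_real mult_zero_left diff_zero)
    \<comment> \<open>The constants match exactly: 1 - (1 + 2 lam) / 2 = 1/2 - lam.\<close>
    moreover have "(1 + 2 * lam) * Re (z\<^sup>2 / (1 - z\<^sup>2)) > (1 + 2 * lam) * (- 1/2)"
      using Re_div_one_minus_gt[OF sq[OF z]] assms by (intro mult_strict_left_mono) auto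
    ultimately show ?thesis by (simp add: field_simps)
  qed
  with f have "f \<in> ozaki_close_to_convex lam" by (simp add: ozaki_close_to_convex_def)
  then show thesis using pS by (intro that) (auto simp: P_def)
qed

theorem theorem2p3:
  fixes lam :: real
  assumes "1/2 \<le> lam" and "lam \<le> 1"
  shows "(\<forall>f \<in> ozaki_close_to_convex lam. deriv (deriv f) 0 = 0 \<longrightarrow>
            pre_Schwarzian_norm f \<le> ereal (1 + 2 * lam))
       \<and> \<not> (\<exists>C::real. C < 1 + 2 * lam \<and>
            (\<forall>f \<in> ozaki_close_to_convex lam. deriv (deriv f) 0 = 0 \<longrightarrow>
               pre_Schwarzian_norm f \<le> ereal C))"
proof (intro conjI ballI impI notI)
  fix f assume f: "f \<in> ozaki_close_to_convex lam" and f2: "deriv (deriv f) 0 = 0"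
  have an: "f analytic_on unit_disc" and df: "\<And>z. z \<in> unit_disc \<Longrightarrow> deriv f z \<noteq> 0"
    and Re: "\<And>z. z \<in> unit_disc \<Longrightarrow> Re (1 + z * deriv (deriv f) z / deriv f z) > 1/2 - lam"
    using f by (auto simp: ozaki_close_to_convex_def locally_univalent_def)
  have "f holomorphic_on unit_disc" using an by (rule analytic_imp_holomorphic)
  then have hol: "pre_Schwarzian f holomorphic_on unit_disc"
    unfolding pre_Schwarzian_def[abs_def] using df by (intro holomorphic_intros) auto
  show "pre_Schwarzian_norm f \<le> ereal (1 + 2 * lam)"
    unfolding pre_Schwarzian_norm_def
  proof (rule SUP_least)
    fix z :: complex assume z: "z \<in> unit_disc"
    have "(1 - (cmod z)\<^sup>2) * cmod (pre_Schwarzian f z) \<le> 2 * (1/2 + lam) * cmod z"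
    proof (rule growth_of_Re_bounded_below[OF _ hol _ _ z])
      show "- (1/2 + lam) < Re (z * pre_Schwarzian f z)" if "z \<in> unit_disc" for z
        using Re[OF that] by (simp add: pre_Schwarzian_def)
    qed (use assms f2 in \<open>auto simp: pre_Schwarzian_def\<close>)
    also have "\<dots> \<le> 2 * (1/2 + lam) * 1"
      using z assms by (intro mult_left_mono) auto
    finally show "ereal ((1 - (cmod z)\<^sup>2) * cmod (pre_Schwarzian f z)) \<le> ereal (1 + 2 * lam)"
      by simp
  qed
next
  assume "\<exists>C::real. C < 1 + 2 * lam \<and>
            (\<forall>f \<in> ozaki_close_to_convex lam. deriv (deriv f) 0 = 0 \<longrightarrow>
               pre_Schwarzian_norm f \<le> ereal C)"
  then obtain C :: real where C: "C < 1 + 2 * lam"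
    and le: "\<And>f. f \<in> ozaki_close_to_convex lam \<Longrightarrow> deriv (deriv f) 0 = 0 \<Longrightarrow>
               pre_Schwarzian_norm f \<le> ereal C" by blast
  obtain f where f: "f \<in> ozaki_close_to_convex lam"
    and pS: "\<And>z. z \<in> unit_disc \<Longrightarrow> pre_Schwarzian f z = of_real (1 + 2 * lam) * z / (1 - z\<^sup>2)"
    using extremal_ozaki_close_to_convex[OF assms(1)] by blast
  have "deriv f 0 = 1" using f by (simp add: ozaki_close_to_convex_def class_A_def)
  then have "deriv (deriv f) 0 = 0" using pS[of 0] by (simp add: pre_Schwarzian_def)
  with le f have norm_le: "pre_Schwarzian_norm f \<le> ereal C" by blast
  \<comment> \<open>Any x in (t, 1) has (1 + 2 lam) x > C. The maximum with 0 keeps x positive even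
    if C is negative.\<close>
  define t where "t = max 0 (C / (1 + 2 * lam))"
  have "t < 1" using C assms by (simp add: t_def)
  then obtain x where x: "t < x" "x < 1" using dense by blast
  have x0: "0 < x" and Cx: "C < (1 + 2 * lam) * x"
    using x assms by (auto simp: t_def field_simps)
  have x2: "0 < 1 - x\<^sup>2" using x x0 by (simp add: power_less_one_iff)
  have "pre_Schwarzian f (of_real x) = of_real ((1 + 2 * lam) * x / (1 - x\<^sup>2))"
    using pS[of "of_real x"] x x0 by simp
  then have "cmod (pre_Schwarzian f (of_real x)) = (1 + 2 * lam) * x / (1 - x\<^sup>2)"
    using x0 x2 assms by (simp only: norm_of_real) (simp add: abs_mult)
  \<comment> \<open>On the positive real axis the weight cancels the denominator 1 - x^2
    exactly.\<close>
  then have "(1 - (cmod (of_real x))\<^sup>2) * cmod (pre_Schwarzian f (of_real x)) = (1 + 2 * lam) * x"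
    using x2 by simp
  moreover have "ereal ((1 - (cmod (of_real x))\<^sup>2) * cmod (pre_Schwarzian f (of_real x)))
      \<le> pre_Schwarzian_norm f"
    unfolding pre_Schwarzian_norm_def by (rule SUP_upper) (use x x0 in auto)
  ultimately have "ereal ((1 + 2 * lam) * x) \<le> ereal C" using norm_le by (metis order_trans)
  with Cx show False by simp
qed

end
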